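(* Let $\pi$ be a set partition with $\mathrm{pm}(\pi)\geq 1$. Then there exists a constant $c_1(\pi)>0$ such that for all positive integers $n$, \[B_n(\pi)\geq c_1(\pi)^n\, n^{n\left(1-\frac{1}{\mathrm{pm}(\pi)}\right)}.\]
   Context: A set partition of $[N]$ is a partition of $[N]$ into nonempty unordered blocks. A set partition $\pi$ of $[N]$ contains a set partition $\pi'$ of $[M]$ if there is $S\subseteq[N]$, $|S|=M$, such that the restriction of $\pi$ to $S$, transported to $[M]$ via the order-preserving bijection $S\to[M]$, equals $\pi'$; otherwise $\pi$ avoids $\pi'$. $B_n(\pi)$ denotes the number of set partitions of $[n]$ avoiding $\pi$. For permutations $\sigma_1,\ldots,\sigma_d$ of $[m]$, $[\sigma_1,\ldots,\sigma_d]$ is the set partition of $[(d+1)m]$ with blocks $T_i=\{i,m+\sigma_1(i),2m+\sigma_2(i),\ldots,dm+\sigma_d(i)\}$, $i\in[m]$ (for $d=0$ this is the partition of $[m]$ into singletons). The permutability $\mathrm{pm}(\pi)$ of a set partition $\pi$ is the minimum $d\ge 0$ such that there exist $m$ and permutations $\sigma_1,\ldots,\sigma_d\in S_m$ with $[\sigma_1,\ldots,\sigma_d]$ containing $\pi$. *)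

theory Defs
  imports Complex_Main "HOL-Library.Disjoint_Sets" "HOL-Combinatorics.Permutations"
begin

text \<open>
  A set partition of [N] is a set of blocks \<^term>\<open>P\<close> with \<^term>\<open>partition_on {1..N} P\<close>;
  its ground set is recovered as \<^term>\<open>\<Union>P\<close>, so the size N is not passed around separately.
\<close>

definition restrict_partition :: "nat set set \<Rightarrow> nat set \<Rightarrow> nat set set" where
  "restrict_partition P S = (\<lambda>B. B \<inter> S) ` P - {{}}"

text \<open>
  When \<^term>\<open>Q\<close> is a set partition of [M], \<^term>\<open>f\<close> below is the unique order-preserving
  bijection from \<^term>\<open>S\<close> to [M]; its existence forces \<^term>\<open>card S = M\<close>.
\<close>

definition contains_partition :: "nat set set \<Rightarrow> nat set set \<Rightarrow> bool" where
  "contains_partition P Q \<longleftrightarrow>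
     (\<exists>S \<subseteq> \<Union>P. \<exists>f. bij_betw f S (\<Union>Q) \<and> strict_mono_on S f \<and>
        (\<lambda>B. f ` B) ` restrict_partition P S = Q)"

definition num_avoiding :: "nat \<Rightarrow> nat set set \<Rightarrow> nat" where
  "num_avoiding n Q = card {P. partition_on {1..n} P \<and> \<not> contains_partition P Q}"

text \<open>
  The partition $[\sigma_1,\ldots,\sigma_d]$ of $[(d+1)m]$. Lists are indexed from 0, so
  $\sigma_j$ is \<^term>\<open>\<sigma>s ! (j - 1)\<close>.
\<close>

definition perm_partition :: "nat \<Rightarrow> (nat \<Rightarrow> nat) list \<Rightarrow> nat set set" where
  "perm_partition m \<sigma>s =
     (\<lambda>i. insert i {j * m + (\<sigma>s ! (j - 1)) i | j. 1 \<le> j \<and> j \<le> length \<sigma>s}) ` {1..m}"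

definition permutability :: "nat set set \<Rightarrow> nat" where
  "permutability Q =
     (LEAST d. \<exists>m \<sigma>s. length \<sigma>s = d \<and> (\<forall>\<sigma> \<in> set \<sigma>s. \<sigma> permutes {1..m}) \<and>
        contains_partition (perm_partition m \<sigma>s) Q)"

text \<open>The set minimised over is never empty for a set partition of some [k].\<close>

lemma permutability_attained:
  assumes "partition_on {1..k} Q"
  shows "\<exists>m \<sigma>s. length \<sigma>s = permutability Q \<and> (\<forall>\<sigma> \<in> set \<sigma>s. \<sigma> permutes {1..m}) \<and>
           contains_partition (perm_partition m \<sigma>s) Q"
proof -
  let ?\<sigma> = "replicate k (id :: nat \<Rightarrow> nat)"
  define T where "T i = insert i {j * k + (?\<sigma> ! (j - 1)) i | j. 1 \<le> j \<and> j \<le> length ?\<sigma>}" for i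
  have T_eq: "T i = {j * k + i | j. j \<le> k}" for i
  proof (intro set_eqI iffI)
    fix x assume "x \<in> T i"
    then consider "x = i" | j where "x = j * k + (?\<sigma> ! (j - 1)) i" "1 \<le> j" "j \<le> k"
      unfolding T_def by auto
    then show "x \<in> {j * k + i | j. j \<le> k}"
    proof cases
      case 1
      then have "x = 0 * k + i \<and> 0 \<le> k" by simp
      then show ?thesis by blast
    next
      case 2
      then show ?thesis by (auto intro: exI[of _ j])
    qed
  next
    fix x assume "x \<in> {j * k + i | j. j \<le> k}"
    then obtain j where j: "x = j * k + i" "j \<le> k" by auto
    show "x \<in> T i"
    proof (cases "j = 0")
      case True
      then show ?thesis using j by (simp add: T_def)
    next
      case False
      then have "x = j * k + (?\<sigma> ! (j - 1)) i" "1 \<le> j" "j \<le> length ?\<sigma>"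
        using j by auto
      then show ?thesis unfolding T_def by blast
    qed
  qed
  have PP: "perm_partition k ?\<sigma> = T ` {1..k}"
    unfolding perm_partition_def T_def by simp
  have un: "\<Union>Q = {1..k}" and ne: "{} \<notin> Q" and dj: "disjoint Q"
    using assms by (auto simp: partition_on_def)
  define b where "b t = Min (THE B. B \<in> Q \<and> t \<in> B)" for t
  have b: "b t = Min B" if "B \<in> Q" "t \<in> B" for B t
  proof -
    have "(THE B. B \<in> Q \<and> t \<in> B) = B"
      by (rule the_equality) (use that dj in \<open>auto simp: disjoint_def\<close>)
    then show ?thesis by (simp add: b_def)
  qed
  have Min_in: "Min B \<in> B" if "B \<in> Q" for B
  proof (rule Min_in)
    show "finite B" using that un by (metis Union_upper finite_atLeastAtMost finite_subset)
    show "B \<noteq> {}" using that ne by auto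
  qed
  have b_rng: "b t \<in> {1..k}" if "t \<in> {1..k}" for t
    using that un b Min_in by (metis UnionE UnionI)
  define g where "g t = (t - 1) * k + b t" for t
  have g_mono: "g s < g t" if "s \<in> {1..k}" "t \<in> {1..k}" "s < t" for s t
  proof -
    have "g s \<le> (s - 1) * k + k" using b_rng[OF that(1)] by (simp add: g_def)
    also have "\<dots> = s * k" using that(1) by (cases s) auto
    also have "\<dots> \<le> (t - 1) * k" using that by (intro mult_right_mono) auto
    also have "\<dots> < g t" using b_rng[OF that(2)] by (simp add: g_def)
    finally show ?thesis .
  qed
  have g_inj: "inj_on g {1..k}"
    by (rule inj_onI) (metis g_mono less_irrefl linorder_neqE_nat)
  define f where "f = inv_into {1..k} g"
  have fg: "f (g t) = t" if "t \<in> {1..k}" for t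
    using that g_inj by (simp add: f_def)
  have g_in_T: "g t \<in> T i \<longleftrightarrow> b t = i" if "t \<in> {1..k}" "i \<in> {1..k}" for t i
  proof
    assume "g t \<in> T i"
    then obtain j where "(t - 1) * k + b t = j * k + i" by (auto simp: T_eq g_def)
    then have "(t - 1) * k + (b t - 1) = j * k + (i - 1)"
      using b_rng[OF that(1)] that(2) by auto
    then have "((t - 1) * k + (b t - 1)) mod k = (j * k + (i - 1)) mod k" by simp
    moreover have "b t - 1 < k" "i - 1 < k" using b_rng[OF that(1)] that(2) by auto
    ultimately have "b t - 1 = i - 1" by simp
    then show "b t = i" using b_rng[OF that(1)] that(2) by auto
  next
    assume "b t = i"
    then show "g t \<in> T i" using that by (auto simp: T_eq g_def intro!: exI[of _ "t - 1"])
  qed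
  have img: "f ` (T i \<inter> g ` {1..k}) = {t \<in> {1..k}. b t = i}" if "i \<in> {1..k}" for i
    using g_in_T fg that by (force simp: image_iff)
  have block: "{t \<in> {1..k}. b t = Min B} = B" if "B \<in> Q" for B
  proof
    show "B \<subseteq> {t \<in> {1..k}. b t = Min B}" using that b un by blast
  next
    show "{t \<in> {1..k}. b t = Min B} \<subseteq> B"
    proof
      fix t assume "t \<in> {t \<in> {1..k}. b t = Min B}"
      then obtain C where C: "C \<in> Q" "t \<in> C" "b t = Min B" using un by blast
      then have "Min C = Min B" using b by metis
      then have "Min B \<in> C" using C Min_in by metis
      then have "C = B" using C that Min_in[OF that] dj by (auto simp: disjoint_def)
      then show "t \<in> B" using C by simp
    qed
  qed
  have "contains_partition (perm_partition k ?\<sigma>) Q"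
    unfolding contains_partition_def
  proof (intro exI[of _ "g ` {1..k}"] exI[of _ f] conjI)
    show "g ` {1..k} \<subseteq> \<Union>(perm_partition k ?\<sigma>)"
      using g_in_T b_rng by (force simp: PP)
    show "bij_betw f (g ` {1..k}) (\<Union>Q)"
      unfolding un f_def by (rule bij_betw_inv_into) (rule inj_on_imp_bij_betw[OF g_inj])
    show "strict_mono_on (g ` {1..k}) f"
    proof (rule strict_mono_onI)
      fix x y assume "x \<in> g ` {1..k}" "y \<in> g ` {1..k}" "x < y"
      then obtain s t where st: "s \<in> {1..k}" "t \<in> {1..k}" "x = g s" "y = g t" "g s < g t" by auto
      then have "s < t" by (metis g_mono less_asym' linorder_neqE_nat)
      then show "f x < f y" using st fg by simp
    qed
    have "(\<lambda>B. f ` B) ` restrict_partition (perm_partition k ?\<sigma>) (g ` {1..k})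
          = (\<lambda>i. {t \<in> {1..k}. b t = i}) ` {1..k} - {{}}" (is "?L = ?R")
    proof
      show "?L \<subseteq> ?R"
      proof
        fix X assume "X \<in> ?L"
        then obtain i where i: "i \<in> {1..k}" "X = f ` (T i \<inter> g ` {1..k})"
            "T i \<inter> g ` {1..k} \<noteq> {}"
          unfolding restrict_partition_def PP by blast
        have X: "X = {t \<in> {1..k}. b t = i}" using i(2) img[OF i(1)] by (rule trans)
        have "X \<noteq> {}" unfolding i(2) image_is_empty by (rule i(3))
        then show "X \<in> ?R" unfolding X using i(1) by blast
      qed
      show "?R \<subseteq> ?L"
      proof
        fix X assume "X \<in> ?R"
        then obtain i where i: "i \<in> {1..k}" "X = {t \<in> {1..k}. b t = i}" "X \<noteq> {}" by blast
        then have X: "X = f ` (T i \<inter> g ` {1..k})" using img by simp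
        then have "T i \<inter> g ` {1..k} \<noteq> {}" using i(3) by blast
        then show "X \<in> ?L" using i(1) unfolding X restrict_partition_def PP by (intro imageI DiffI) simp_all
      qed
    qed
    also have "\<dots> = Q"
    proof
      show "?R \<subseteq> Q"
      proof
        fix X assume "X \<in> ?R"
        then obtain i t where i: "X = {t \<in> {1..k}. b t = i}" "t \<in> {1..k}" "b t = i" by blast
        then obtain B where "B \<in> Q" "t \<in> B" using un by blast
        then show "X \<in> Q" using i b block by metis
      qed
      show "Q \<subseteq> ?R"
      proof
        fix B assume B: "B \<in> Q"
        then have "Min B \<in> {1..k}" using Min_in un by blast
        moreover have "B \<noteq> {}" using B ne by metis
          ultimately show "B \<in> ?R" by (intro DiffI image_eqI[of _ _ "Min B"]) (simp_all only: block[OF B] singleton_iff not_False_eq_True)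
      qed
    qed
    finally show "(\<lambda>B. f ` B) ` restrict_partition (perm_partition k ?\<sigma>) (g ` {1..k}) = Q" .
  qed
  then have "\<exists>d m \<sigma>s. length \<sigma>s = d \<and> (\<forall>\<sigma> \<in> set \<sigma>s. \<sigma> permutes {1..m}) \<and>
      contains_partition (perm_partition m \<sigma>s) Q"
    by (intro exI[of _ k] exI[of _ ?\<sigma>]) (auto simp: permutes_id)
  then show ?thesis
    unfolding permutability_def by (rule LeastI_ex)
qed

end

theory Submission
  imports Defs
begin

text \<open>
  Write $d = \mathrm{pm}(\pi)$. By minimality of $d$ every partition $[\sigma_1,\ldots,\sigma_{d-1}]$
  avoids $\pi$, and so do its restrictions to initial segments $[n]$. Take permutations of $[m]$ with
  $m = \lfloor n/d \rfloor + 1$, so that $dm \geq n$, all of them fixing every element above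
  $p = \max(m - d, 0)$. Then the last elements, which restriction to $[n]$ cuts off, carry no information,
  and the restriction still determines $(\sigma_1,\ldots,\sigma_{d-1})$. Hence
  $B_n(\pi) \geq (p!)^{d-1}$. Finally $n^{n/d} \leq n^{p+d} \leq p!\, d!\, e^{2n}$, as
  $n^k \leq k!\, e^n$ for every $k$.
\<close>

section \<open>Restriction to a subset of the ground set\<close>

lemma restrict_partition_restrict:
  assumes "S \<subseteq> A"
  shows "restrict_partition (restrict_partition P A) S = restrict_partition P S"
proof -
  have eq: "B \<inter> A \<inter> S = B \<inter> S" for B using assms by blast
  show ?thesis
  proof (rule set_eqI)
    fix X
    have "X \<in> restrict_partition (restrict_partition P A) S \<longleftrightarrow>
        X \<noteq> {} \<and> (\<exists>B\<in>P. B \<inter> A \<noteq> {} \<and> X = B \<inter> A \<inter> S)"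
      unfolding restrict_partition_def by blast
    also have "\<dots> \<longleftrightarrow> X \<in> restrict_partition P S"
      unfolding restrict_partition_def eq using assms by blast
    finally show "X \<in> restrict_partition (restrict_partition P A) S \<longleftrightarrow> X \<in> restrict_partition P S" .
  qed
qed

lemma partition_on_restrict_partition:
  assumes "partition_on A P" "S \<subseteq> A"
  shows "partition_on S (restrict_partition P S)"
proof -
  have "partition_on (S \<inter> A) ((\<inter>) S ` P - {{}})"
    using assms(1) by (rule partition_on_restrict)
  moreover have "S \<inter> A = S" using assms(2) by blast
  ultimately show ?thesis by (simp add: restrict_partition_def Int_commute)
qed

text \<open>A witness set for the restriction already lies in \<open>A\<close>, so intersecting with
  \<open>A\<close> first changes nothing, and the same set and bijection serve for \<open>P\<close>.
  The contrapositive passes avoidance down to initial segments.\<close>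

lemma contains_partition_restrictD:
  assumes "contains_partition (restrict_partition P A) Q"
  shows "contains_partition P Q"
proof -
  obtain S f where S: "S \<subseteq> \<Union>(restrict_partition P A)" and f: "bij_betw f S (\<Union>Q)"
    "strict_mono_on S f" "(\<lambda>B. f ` B) ` restrict_partition (restrict_partition P A) S = Q"
    using assms unfolding contains_partition_def by blast
  have "S \<subseteq> A" "S \<subseteq> \<Union>P" using S by (auto simp: restrict_partition_def)
  then show ?thesis
    unfolding contains_partition_def using f by (metis restrict_partition_restrict)
qed

section \<open>The blocks given by a list of permutations\<close>

lemma mult_add_eq_iff:
  fixes m :: nat
  assumes "l \<in> {1..m}" "l' \<in> {1..m}"
  shows "j * m + l = j' * m + l' \<longleftrightarrow> j = j' \<and> l = l'"
proof
  assume "j * m + l = j' * m + l'"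
  \<comment> \<open>The offsets run over {1..m}; lowered by one they are below \<open>m\<close>, so
    that \<open>div m\<close> recovers \<open>j\<close>.\<close>
  then have eq: "(l - 1) + j * m = (l' - 1) + j' * m" using assms by auto
  have lt: "l - 1 < m" "l' - 1 < m" using assms by auto
  have "((l - 1) + j * m) div m = j" "((l' - 1) + j' * m) div m = j'"
    using lt by auto
  then have "j = j'" using eq by simp
  then show "j = j' \<and> l = l'" using eq assms by auto
qed simp

text \<open>Prepending \<open>id\<close> treats the ground layer {1..m} like the others: layer
  \<open>j\<close> carries the \<open>j\<close>-th permutation for every \<open>j\<close> from 0,
  without a separate case for the element \<open>i\<close>.\<close>

definition perm_block :: "nat \<Rightarrow> (nat \<Rightarrow> nat) list \<Rightarrow> nat \<Rightarrow> nat set" where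
  "perm_block m \<sigma>s i = (\<lambda>j. j * m + ((id # \<sigma>s) ! j) i) ` {..length \<sigma>s}"

lemma perm_partition_eq: "perm_partition m \<sigma>s = perm_block m \<sigma>s ` {1..m}"
proof -
  have "insert i {j * m + (\<sigma>s ! (j - 1)) i | j. 1 \<le> j \<and> j \<le> length \<sigma>s} = perm_block m \<sigma>s i" for i
  proof -
    have "{..length \<sigma>s} = insert 0 {j. 1 \<le> j \<and> j \<le> length \<sigma>s}" by auto
    then show ?thesis unfolding perm_block_def by (auto simp: nth_Cons')
  qed
  then show ?thesis unfolding perm_partition_def by simp
qed

lemma nth_permutes:
  assumes "\<forall>\<sigma> \<in> set \<sigma>s. \<sigma> permutes A" "j \<le> length \<sigma>s"
  shows "((id # \<sigma>s) ! j) permutes A"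
  using assms by (cases j) (auto simp: permutes_id)

text \<open>Layer and offset of a point are unique, so a block meets each layer in exactly one
  point. Hence the block through \<open>i\<close> records the value of every permutation at
  \<open>i\<close>.\<close>

lemma mem_perm_block_iff:
  assumes "\<forall>\<sigma> \<in> set \<sigma>s. \<sigma> permutes {1..m}" "i \<in> {1..m}" "l \<in> {1..m}"
  shows "j * m + l \<in> perm_block m \<sigma>s i \<longleftrightarrow> j \<le> length \<sigma>s \<and> l = ((id # \<sigma>s) ! j) i"
proof -
  have "j * m + l = j' * m + ((id # \<sigma>s) ! j') i \<longleftrightarrow> j = j' \<and> l = ((id # \<sigma>s) ! j') i"
    if "j' \<le> length \<sigma>s" for j'
    using nth_permutes[OF assms(1) that] assms(2,3)
    by (intro mult_add_eq_iff) (simp_all only: permutes_in_image)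
  then show ?thesis unfolding perm_block_def by blast
qed

text \<open>Surjectivity of the permutation on each layer makes the blocks cover that layer, and
  injectivity makes them disjoint there.\<close>

lemma partition_on_perm_partition:
  assumes "\<forall>\<sigma> \<in> set \<sigma>s. \<sigma> permutes {1..m}"
  shows "partition_on {1..(length \<sigma>s + 1) * m} (perm_partition m \<sigma>s)"
proof -
  have range: "((id # \<sigma>s) ! j) i \<in> {1..m}" if "j \<le> length \<sigma>s" "i \<in> {1..m}" for i j
    using nth_permutes[OF assms that(1)] that(2) by (simp only: permutes_in_image)
  have "\<Union>(perm_partition m \<sigma>s) = {1..(length \<sigma>s + 1) * m}"
  proof (intro equalityI subsetI)
    fix x assume "x \<in> \<Union>(perm_partition m \<sigma>s)"
    then obtain i j where i: "i \<in> {1..m}" "j \<le> length \<sigma>s" "x = j * m + ((id # \<sigma>s) ! j) i"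
      by (auto simp: perm_partition_eq perm_block_def)
    have "j * m \<le> length \<sigma>s * m" using i(2) by (rule mult_le_mono1)
    then show "x \<in> {1..(length \<sigma>s + 1) * m}"
      using range[OF i(2,1)] unfolding i(3) atLeastAtMost_iff add_mult_distrib by linarith
  next
    fix x assume x: "x \<in> {1..(length \<sigma>s + 1) * m}"
    then have "m > 0" by (cases m) auto
    define j l where "j = (x - 1) div m" and "l = (x - 1) mod m + 1"
    have l: "l \<in> {1..m}" using \<open>m > 0\<close> by (simp add: l_def Suc_leI)
    have xjl: "x = j * m + l" using x by (simp add: j_def l_def)
    have "x - 1 < (length \<sigma>s + 1) * m" using x by auto
    then have "j < length \<sigma>s + 1" unfolding j_def by (rule less_mult_imp_div_less)
    then have j: "j \<le> length \<sigma>s" by simp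
    obtain i where i: "i \<in> {1..m}" "l = ((id # \<sigma>s) ! j) i"
      using permutes_image[OF nth_permutes[OF assms j]] l by blast
    then show "x \<in> \<Union>(perm_partition m \<sigma>s)"
      unfolding xjl perm_partition_eq using mem_perm_block_iff[OF assms i(1) l] j by blast
  qed
  moreover have "perm_block m \<sigma>s i = perm_block m \<sigma>s i'"
    if mem: "i \<in> {1..m}" "i' \<in> {1..m}" "x \<in> perm_block m \<sigma>s i" "x \<in> perm_block m \<sigma>s i'" for i i' x
  proof -
    obtain j where j: "j \<le> length \<sigma>s" "x = j * m + ((id # \<sigma>s) ! j) i"
      using mem(3) by (auto simp: perm_block_def)
    have "((id # \<sigma>s) ! j) i = ((id # \<sigma>s) ! j) i'"
      using mem(4) mem_perm_block_iff[OF assms mem(2) range[OF j(1) mem(1)]] j(2) by blast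
    then have "i = i'"
      using permutes_inj[OF nth_permutes[OF assms j(1)]] by (rule injD[rotated])
    then show ?thesis by simp
  qed
  then have "disjoint (perm_partition m \<sigma>s)"
    unfolding perm_partition_eq disjoint_def by blast
  moreover have "{} \<notin> perm_partition m \<sigma>s"
    by (auto simp: perm_partition_eq perm_block_def)
  ultimately show ?thesis by (simp add: partition_on_def)
qed

section \<open>Counting avoiding partitions\<close>

lemma perm_partition_avoids:
  assumes "\<forall>\<sigma> \<in> set \<sigma>s. \<sigma> permutes {1..m}" "length \<sigma>s < permutability Q"
  shows "\<not> contains_partition (perm_partition m \<sigma>s) Q"
  using not_less_Least[OF assms(2)[unfolded permutability_def]] assms(1) by blast

text \<open>All values at points of {1..p} sit at positions up to \<open>r * m + p\<close>, hence
  survive the restriction, and every other point is fixed. The bound is asked for only when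
  \<open>r\<close> and \<open>p\<close> are positive: otherwise the domain is a single list.\<close>

lemma inj_on_restrict_perm_partition:
  assumes "p \<le> m" "r > 0 \<Longrightarrow> p > 0 \<Longrightarrow> r * m + p \<le> n"
  shows "inj_on (\<lambda>\<sigma>s. restrict_partition (perm_partition m \<sigma>s) {1..n})
           {\<sigma>s. set \<sigma>s \<subseteq> {\<sigma>. \<sigma> permutes {1..p}} \<and> length \<sigma>s = r}"
proof (rule inj_onI)
  fix \<sigma>s \<tau>s :: "(nat \<Rightarrow> nat) list"
  assume "\<sigma>s \<in> {\<sigma>s. set \<sigma>s \<subseteq> {\<sigma>. \<sigma> permutes {1..p}} \<and> length \<sigma>s = r}"
    and "\<tau>s \<in> {\<sigma>s. set \<sigma>s \<subseteq> {\<sigma>. \<sigma> permutes {1..p}} \<and> length \<sigma>s = r}"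
    and eq: "restrict_partition (perm_partition m \<sigma>s) {1..n} =
      restrict_partition (perm_partition m \<tau>s) {1..n}"
  then have len: "length \<sigma>s = r" "length \<tau>s = r"
    and perm: "\<And>\<sigma>. \<sigma> \<in> set \<sigma>s \<Longrightarrow> \<sigma> permutes {1..p}" "\<And>\<tau>. \<tau> \<in> set \<tau>s \<Longrightarrow> \<tau> permutes {1..p}"
    by auto
  have perm': "\<forall>\<sigma> \<in> set \<sigma>s. \<sigma> permutes {1..m}" "\<forall>\<tau> \<in> set \<tau>s. \<tau> permutes {1..m}"
    using perm assms(1) by (auto intro!: permutes_subset[of _ "{1..p}" "{1..m}"] simp del: One_nat_def)
  have "(\<sigma>s ! j) i = (\<tau>s ! j) i" if j: "j < r" for i j
  proof (cases "i \<in> {1..p}")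
    case False
    then show ?thesis using perm j len by (metis nth_mem permutes_not_in)
  next
    case True
    have bnd: "r * m + p \<le> n" using True j by (intro assms(2)) auto
    have im: "i \<in> {1..m}" and "i \<in> {1..n}" using True assms(1) bnd by auto
    have i_mem: "i \<in> perm_block m \<sigma>s i \<inter> {1..n}"
      using mem_perm_block_iff[OF perm'(1) im im, of 0] \<open>i \<in> {1..n}\<close> by simp
    then have "perm_block m \<sigma>s i \<inter> {1..n} \<noteq> {}" by (metis empty_iff)
    then have "perm_block m \<sigma>s i \<inter> {1..n} \<in> restrict_partition (perm_partition m \<sigma>s) {1..n}"
      unfolding restrict_partition_def perm_partition_eq
      using im by (intro DiffI imageI) simp_all
    then obtain i' where i': "i' \<in> {1..m}"
      "perm_block m \<sigma>s i \<inter> {1..n} = perm_block m \<tau>s i' \<inter> {1..n}"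
      unfolding eq unfolding restrict_partition_def perm_partition_eq by (elim DiffE imageE) simp
    \<comment> \<open>The ground layer belongs to \<open>id\<close>, so \<open>i'\<close> is the
      only element of {1..m} in its block.\<close>
    have "i = i'"
      using i_mem mem_perm_block_iff[OF perm'(2) i'(1) im, of 0] unfolding i'(2) by simp
    let ?l = "(\<sigma>s ! j) i"
    have lp: "?l \<in> {1..p}"
      using True perm(1)[OF nth_mem, of j] j len by (simp only: permutes_in_image)
    then have lm: "?l \<in> {1..m}" using assms(1) by auto
    have "Suc j * m + ?l \<in> perm_block m \<sigma>s i"
      using mem_perm_block_iff[OF perm'(1) im lm, of "Suc j"] j len by (simp del: mult_Suc)
    moreover have "Suc j * m \<le> r * m" using j by (intro mult_le_mono1) simp
    then have "Suc j * m + ?l \<in> {1..n}" using lp bnd by auto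
    ultimately have "Suc j * m + ?l \<in> perm_block m \<tau>s i" using i'(2) \<open>i = i'\<close> by blast
    then show ?thesis using mem_perm_block_iff[OF perm'(2) im lm, of "Suc j"] by (simp del: mult_Suc)
  qed
  then show "\<sigma>s = \<tau>s" using len by (intro nth_equalityI ext) auto
qed

lemma num_avoiding_ge:
  assumes "permutability Q = Suc r"
  shows "fact (Suc (n div Suc r) - Suc r) ^ r \<le> num_avoiding n Q"
proof -
  \<comment> \<open>This gives n < Suc r * m \<le> n + Suc r: the ground set covers {1..n}, and the
    restriction loses at most \<open>Suc r\<close> points.\<close>
  define m where "m = Suc (n div Suc r)"
  \<comment> \<open>If p > 0, then \<open>r * m + p\<close> equals
    \<open>Suc r * (n div Suc r)\<close>, which is at most \<open>n\<close>. If the subtraction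
    truncates to 0, the claimed lower bound is just 1.\<close>
  define p where "p = m - Suc r"
  define L where "L = {\<sigma>s. set \<sigma>s \<subseteq> {\<sigma>. \<sigma> permutes {1..p}} \<and> length \<sigma>s = r}"
  let ?F = "\<lambda>\<sigma>s. restrict_partition (perm_partition m \<sigma>s) {1..n}"
  let ?R = "{P. partition_on {1..n} P \<and> \<not> contains_partition P Q}"
  have n: "Suc r * (n div Suc r) + n mod Suc r = n" by (rule mult_div_mod_eq)
  have "n mod Suc r < Suc r" by simp
  then have nle: "n \<le> (r + 1) * m" using n unfolding m_def Suc_eq_plus1[symmetric] mult_Suc_right by linarith
  have bnd: "r * m + p \<le> n" if "p > 0"
  proof -
    have "p + Suc r = m" using that by (simp add: p_def)
    then have "r * m + p + Suc r = Suc r * (n div Suc r) + Suc r" by (simp add: m_def)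
    then show ?thesis using n by linarith
  qed
  have "?F ` L \<subseteq> ?R"
  proof (rule image_subsetI)
    fix \<sigma>s assume "\<sigma>s \<in> L"
    then have len: "length \<sigma>s = r" and perm: "\<forall>\<sigma> \<in> set \<sigma>s. \<sigma> permutes {1..m}"
      unfolding L_def by (auto intro!: permutes_subset[of _ "{1..p}" "{1..m}"] simp: p_def simp del: One_nat_def)
    have "{1..n} \<subseteq> {1..(length \<sigma>s + 1) * m}" using nle len by auto
    then have "partition_on {1..n} (?F \<sigma>s)"
      by (rule partition_on_restrict_partition[OF partition_on_perm_partition[OF perm]])
    moreover have "\<not> contains_partition (?F \<sigma>s) Q"
      using perm_partition_avoids[OF perm] len assms contains_partition_restrictD by fastforce
    ultimately show "?F \<sigma>s \<in> ?R" by simp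
  qed
  moreover have "inj_on ?F L"
    unfolding L_def by (rule inj_on_restrict_perm_partition) (simp_all only: bnd, simp add: p_def)
  moreover have "finite ?R"
    by (rule finite_subset[OF _ finitely_many_partition_on[of "{1..n}"]]) auto
  ultimately have "card L \<le> card ?R" by (intro card_inj_on_le)
  moreover have "card L = fact p ^ r"
    unfolding L_def by (simp add: card_lists_length_eq finite_permutations card_permutations)
  ultimately show ?thesis unfolding num_avoiding_def p_def m_def by simp
qed

section \<open>Comparing factorials with powers\<close>

lemma power_le_fact_exp:
  fixes x :: real
  assumes "x \<ge> 0"
  shows "x ^ k \<le> fact k * exp x"
proof -
  have "(\<lambda>i. x ^ i / fact i) sums exp x"
    using exp_converges[of x] by (simp add: divide_inverse mult.commute)
  \<comment> \<open>The left side is a single term of a series with nonnegative terms.\<close>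
  then have "x ^ k / fact k \<le> exp x"
    using sum_le_suminf[of "\<lambda>i. x ^ i / fact i" "{k}"] assms by (simp add: sums_iff)
  then show ?thesis by (simp add: field_simps)
qed

theorem theorem3p1:
  fixes k :: nat and \<pi> :: "nat set set"
  assumes "partition_on {1..k} \<pi>"
    and "permutability \<pi> \<ge> 1"
  shows "\<exists>c::real. c > 0 \<and> (\<forall>n::nat. n \<ge> 1 \<longrightarrow>
           real (num_avoiding n \<pi>) \<ge>
             c ^ n * real n powr (real n * (1 - 1 / real (permutability \<pi>))))"
proof -
  define d where "d = permutability \<pi>"
  obtain r where r: "d = Suc r" using assms(2) unfolding d_def by (cases "permutability \<pi>") auto
  \<comment> \<open>\<open>b\<close> absorbs the constant d! and the two factors
    \<open>exp (real n)\<close> that arise below; the constant of the theorem is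
    \<open>b ^ r\<close>.\<close>
  define b :: real where "b = inverse (fact d * exp 2)"
  have "b > 0" by (simp add: b_def)
  have "(b ^ r) ^ n * real n powr (real n * (1 - 1 / real d)) \<le> real (num_avoiding n \<pi>)"
    if "n \<ge> 1" for n
  proof -
    define p where "p = Suc (n div d) - d"
    have "d * (n div d) + n mod d = n" "n mod d < d" by (simp_all add: r del: mult_Suc)
    then have "n \<le> d * Suc (n div d)" unfolding mult_Suc_right by linarith
    \<comment> \<open>This holds also when the subtraction in \<open>p\<close> truncates to 0, so
      small \<open>n\<close> need no separate case.\<close>
    also have "\<dots> \<le> d * (p + d)" by (intro mult_le_mono2) (simp add: p_def)
    finally have "real n \<le> real d * real (p + d)" by (metis of_nat_le_iff of_nat_mult)
    then have "real n / real d \<le> real (p + d)" using r by (simp add: field_simps)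
    then have "real n powr (real n / real d) \<le> real n powr real (p + d)"
      using that by (intro powr_mono) auto
    also have "\<dots> = real n ^ p * real n ^ d" using that by (simp add: powr_realpow power_add del: of_nat_add)
    \<comment> \<open>Estimating the two powers separately produces exactly p!, with d! independent
      of \<open>n\<close>, instead of (p + d)!.\<close>
    also have "\<dots> \<le> (fact p * exp (real n)) * (fact d * exp (real n))"
      by (intro mult_mono power_le_fact_exp) auto
    also have "\<dots> = fact p * (fact d * exp 2 ^ n)"
      by (simp add: exp_of_nat_mult[symmetric] exp_add[symmetric] mult_ac)
    \<comment> \<open>Since n \<ge> 1, d! may be raised to the power \<open>n\<close>, which turns
      the whole loss into an \<open>n\<close>-th power.\<close>
    also have "\<dots> \<le> fact p * (fact d ^ n * exp 2 ^ n)"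
      using that by (intro mult_left_mono mult_right_mono self_le_power) (auto simp: fact_ge_1)
    finally have "real n powr (real n / real d) \<le> fact p * inverse b ^ n"
      by (simp add: b_def power_mult_distrib)
    then have *: "b ^ n * real n powr (real n / real d) \<le> fact p"
      using \<open>b > 0\<close> by (simp add: field_simps)
    \<comment> \<open>As r = d - 1, the target exponent is \<open>r\<close> times n/d, so the
      \<open>r\<close>-th power of the estimate for p! is what the count requires.\<close>
    have "real n * (1 - 1 / real d) = real n / real d * real r"
      using r by (simp add: field_simps)
    then have "real n powr (real n * (1 - 1 / real d)) = (real n powr (real n / real d)) powr real r"
      by (simp only: powr_powr)
    also have "\<dots> = (real n powr (real n / real d)) ^ r"
      using that by (intro powr_realpow) simp
    finally have powr_eq: "real n powr (real n * (1 - 1 / real d)) = (real n powr (real n / real d)) ^ r" .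
    have "(b ^ r) ^ n * real n powr (real n * (1 - 1 / real d)) =
        (b ^ n * real n powr (real n / real d)) ^ r"
      unfolding powr_eq by (simp add: power_mult_distrib power_mult[symmetric] mult.commute)
    also have "\<dots> \<le> fact p ^ r" using * \<open>b > 0\<close> by (intro power_mono) auto
    also have "\<dots> \<le> real (num_avoiding n \<pi>)"
    proof -
      have "fact p ^ r \<le> num_avoiding n \<pi>"
        using num_avoiding_ge[of \<pi> r n] r unfolding p_def d_def by simp
      then have "real (fact p ^ r) \<le> real (num_avoiding n \<pi>)" by (simp only: of_nat_le_iff)
      then show ?thesis by simp
    qed
    finally show ?thesis .
  qed
  moreover have "b ^ r > 0" using \<open>b > 0\<close> by simp
  ultimately show ?thesis unfolding d_def by blast
qed

end
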